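(* For every real $\epsilon > 0$, $T_{k} = O(k^{5/2+\epsilon})$ as $k \to \infty$; that is, for every $\epsilon > 0$ there is a constant $C = C(\epsilon) > 0$ such that $T_k \leq C\, k^{5/2+\epsilon}$ for all integers $k \geq 3$.
   Context: Here $\mathbb{N}$ is the set of positive integers and $[m] = \{1, 2, \dots, m\}$. A $t$-coloring of $[tn]$ assigns to each element of $[tn]$ one of $t$ colors; it is called equinumerous if each color is used an equal number of times (i.e. each of the $t$ colors is used exactly $n$ times). An $AP(k)$ is an arithmetic progression of length $k$, i.e. a set $\{a, a+d, \dots, a+(k-1)d\}$ with common difference $d \geq 1$; it lies in $[tn]$ if all of its terms do. An arithmetic progression is called rainbow (with respect to a coloring) if no two of its terms have the same color. For an integer $k \geq 3$, $T_k$ denotes the minimal number $t \in \mathbb{N}$ such that for every $n \in \mathbb{N}$, every equinumerous $t$-coloring of $[tn]$ contains a rainbow $AP(k)$. (It is known that such a $t$ exists for every $k \geq 3$, so $T_k$ is well defined.) *)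

theory Defs
  imports Complex_Main "HOL-Library.FuncSet"
begin

definition equinumerous_coloring :: "nat \<Rightarrow> nat \<Rightarrow> (nat \<Rightarrow> nat) \<Rightarrow> bool" where
  "equinumerous_coloring t n c \<longleftrightarrow>
     c \<in> {1..t * n} \<rightarrow> {1..t} \<and>
     (\<forall>i\<in>{1..t}. card {x \<in> {1..t * n}. c x = i} = n)"

definition is_AP :: "nat \<Rightarrow> nat set \<Rightarrow> bool" where
  "is_AP k A \<longleftrightarrow> (\<exists>a d. d \<ge> 1 \<and> A = (\<lambda>i. a + i * d) ` {..<k})"

definition rainbow :: "(nat \<Rightarrow> nat) \<Rightarrow> nat set \<Rightarrow> bool" where
  "rainbow c A \<longleftrightarrow> inj_on c A"

definition forces_rainbow_AP :: "nat \<Rightarrow> nat \<Rightarrow> bool" where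
  "forces_rainbow_AP k t \<longleftrightarrow>
     (\<forall>n\<ge>1. \<forall>c. equinumerous_coloring t n c \<longrightarrow>
        (\<exists>A. is_AP k A \<and> A \<subseteq> {1..t * n} \<and> rainbow c A))"

text \<open>
  If no \<open>t\<close> forced a rainbow progression, the value of \<open>LEAST\<close> would be
  unspecified; hence an upper bound on \<open>T k\<close> cannot be obtained without showing that
  such a \<open>t\<close> exists.
\<close>

definition T :: "nat \<Rightarrow> nat" where
  "T k = (LEAST t. t \<ge> 1 \<and> forces_rainbow_AP k t)"

end

theory Submission
  imports Defs "HOL-Computational_Algebra.Primes" "HOL-Real_Asymp.Real_Asymp"
begin

text \<open>
  Call \<open>d\<close> rough if it is coprime to \<open>1, \<dots>, k - 1\<close>, and count only the progressions whose common
  difference is rough. A non-rainbow one contains a monochromatic pair whose difference is \<open>m * d\<close>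
  with \<open>m < k\<close>, and this number determines \<open>d\<close>. Hence a pair spoils at most \<open>k\<close> of these
  progressions, without any loss from the number of divisors of its difference.

  With \<open>N = t * n\<close> there are about \<open>N * r / 2\<close> such progressions, where \<open>r\<close> is the number of rough
  \<open>d \<le> x = N / (2 k)\<close>, against at most \<open>t * n\<^sup>2\<close> monochromatic pairs. So \<open>t\<close> of order \<open>k\<^bsup>5/2\<^esup>\<close> forces
  a rainbow progression as soon as \<open>r\<close> is at least a constant times \<open>x / sqrt k\<close> for
  \<open>x \<ge> k\<^bsup>3/2\<^esup>\<close>. If \<open>log x\<close> is at most of order \<open>(log k)\<^sup>2\<close>, the primes in \<open>[k, x]\<close> suffice, by
  Chebyshev's lower bound. For larger \<open>x\<close> Brun's pure sieve applies, its main term being bounded below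
  by comparing the primes with the odd numbers.
\<close>

subsection \<open>Chebyshev's lower bound\<close>

text \<open>
  The numbers \<open>1 / (m * (n choose m))\<close> form the Leibniz harmonic triangle: each is the difference of
  two entries in the previous column.
\<close>

lemma binomial_mult_dvd_common_multiple:
  assumes "1 \<le> m" "m \<le> n" "\<And>j. 1 \<le> j \<Longrightarrow> j \<le> n \<Longrightarrow> j dvd d"
  shows "m * (n choose m) dvd d"
  using assms
proof (induction m arbitrary: n rule: nat_induct_at_least)
  case base
  then show ?case by simp
next
  case (Suc m)
  from Suc.prems(1) obtain l where n: "n = Suc l" by (cases n) auto
  let ?a = "l choose m" and ?b = "n choose m"
  have "m * ?a dvd d" using Suc n by simp
  then obtain z1 where z1: "d = m * ?a * z1" by blast
  have "m * ?b dvd d" using Suc by simp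
  then obtain z2 where z2: "d = m * ?b * z2" by blast
  have b: "(int n - int m) * int ?b = int n * int ?a"
    using binomial_absorb_comp[of n m] Suc.prems(1) n
    by (metis Suc_leD diff_Suc_1 of_nat_diff of_nat_mult)
  have c: "int (Suc m * (n choose Suc m)) = int n * int ?a"
    using Suc_times_binomial_eq[of l m] n by (metis mult.commute of_nat_mult)
  \<comment> \<open>The triangle identity with denominators cleared: if \<open>z1\<close> and
    \<open>z2\<close> are the cofactors of \<open>d\<close> for the entries of column
    \<open>m\<close> in rows \<open>l\<close> and \<open>n\<close>, then \<open>z1 - z2\<close> is
    the cofactor for the next column. Working in \<open>int\<close> makes the subtraction
    exact.\<close>
  have "int m * ((int z1 - int z2) * (int n * int ?a))
        = int n * (int m * int ?a * int z1) - int m * int z2 * (int n * int ?a)"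
    by (simp add: algebra_simps)
  also have "\<dots> = int n * int d - (int n - int m) * (int m * int ?b * int z2)"
    unfolding b[symmetric] by (simp add: z1 algebra_simps)
  also have "int m * int ?b * int z2 = int d"
    by (simp add: z2)
  finally have "int m * ((int z1 - int z2) * (int n * int ?a)) = int m * int d"
    by (simp add: algebra_simps)
  hence "int d = int (Suc m * (n choose Suc m)) * (int z1 - int z2)"
    using Suc.hyps unfolding c by (simp add: mult.commute)
  then have "int (Suc m * (n choose Suc m)) dvd int d" by (rule dvdI)
  then show ?case by (simp only: int_dvd_int_iff)
qed

lemma Lcm_atLeastAtMost_Suc: "Lcm {1..Suc n} = lcm (Suc n) (Lcm {1..n})" for n :: nat
  by (simp add: atLeastAtMostSuc_conv)

lemma Lcm_atLeastAtMost_pos: "Lcm {1..n} > 0" for n :: nat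
  by (rule Nat.gr0I) (simp add: Lcm_0_iff)

lemma prime_power_dvd_Lcm_imp_le:
  fixes p :: nat
  assumes "prime p" "e \<ge> 1" "p ^ e dvd Lcm {1..n}"
  shows "p ^ e \<le> n"
  using assms(3)
proof (induction n)
  case 0
  then show ?case using assms prime_gt_1_nat[OF assms(1)] by simp
next
  case (Suc n)
  have L: "Lcm {1..n} \<noteq> 0" using Lcm_atLeastAtMost_pos[of n] by simp
  have np: "\<not> is_unit p" using assms(1) by auto
  have "e \<le> multiplicity p (lcm (Suc n) (Lcm {1..n}))"
    using Suc.prems L np unfolding Lcm_atLeastAtMost_Suc
    by (subst (asm) power_dvd_iff_le_multiplicity) (auto simp: lcm_eq_0_iff)
  hence "e \<le> multiplicity p (Suc n) \<or> e \<le> multiplicity p (Lcm {1..n})"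
    using L assms(1) by (subst (asm) multiplicity_lcm) (auto simp: max_def split: if_splits)
  hence "p ^ e dvd Suc n \<or> p ^ e dvd Lcm {1..n}"
    using multiplicity_dvd' by blast
  then show ?case
    using Suc.IH by (auto dest: dvd_imp_le)
qed

text \<open>In the prime factorization of the lcm, each prime contributes a power that is at most
  \<open>n\<close>, and only primes up to \<open>n\<close> occur.\<close>

lemma Lcm_le_power_card_primes:
  "Lcm {1..n} \<le> n ^ card {p::nat. prime p \<and> p \<le> n}"
proof -
  let ?L = "Lcm {1..n}"
  have L: "?L \<noteq> 0" using Lcm_atLeastAtMost_pos[of n] by simp
  have bound: "p ^ multiplicity p ?L \<le> n" if "p \<in> prime_factors ?L" for p
  proof (rule prime_power_dvd_Lcm_imp_le)
    show "prime p" using that by auto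
    show "multiplicity p ?L \<ge> 1" using that by (auto simp: prime_factors_multiplicity)
  qed (rule multiplicity_dvd)
  have sub: "prime_factors ?L \<subseteq> {p. prime p \<and> p \<le> n}"
  proof
    fix p assume p: "p \<in> prime_factors ?L"
    have "p ^ 1 \<le> n"
      by (rule prime_power_dvd_Lcm_imp_le) (use p in \<open>auto simp: in_prime_factors_iff\<close>)
    then show "p \<in> {p. prime p \<and> p \<le> n}" using p by auto
  qed
  have "?L = (\<Prod>p\<in>prime_factors ?L. p ^ multiplicity p ?L)"
    by (rule prime_factorization_nat) (rule Lcm_atLeastAtMost_pos)
  also have "\<dots> \<le> (\<Prod>p\<in>prime_factors ?L. n)"
    by (rule prod_mono) (use bound in auto)
  also have "\<dots> = n ^ card (prime_factors ?L)" by simp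
  also have "\<dots> \<le> n ^ card {p. prime p \<and> p \<le> n}"
  proof (cases "n = 0")
    case False
    then show ?thesis using sub by (intro power_increasing card_mono) auto
  next
    case True
    then have "prime_factors ?L = {}" and no_primes: "{p::nat. prime p \<and> p \<le> n} = {}" by auto
    then show ?thesis unfolding no_primes by simp
  qed
  finally show ?thesis .
qed

text \<open>The lcm is squeezed between a multiple of the central binomial coefficient that divides
  it and the power bound just proved. One factor 2 is lost in halving \<open>n\<close>, another in
  the estimate of the central coefficient.\<close>

lemma two_power_le_power_card_primes:
  assumes "n \<ge> 2"
  shows "2 ^ (n - 2) \<le> n ^ card {p::nat. prime p \<and> p \<le> n}"
proof -
  define m where "m = n div 2"
  have m: "m \<ge> 1" "2 * m \<le> n" "n \<le> 2 * m + 1" using assms by (auto simp: m_def)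
  have "real (4 ^ m) \<le> real (2 * m) * real ((2 * m) choose m)"
    using central_binomial_lower_bound[of m] m(1) by (simp add: field_simps)
  hence "4 ^ m \<le> 2 * (m * ((2 * m) choose m))"
    by (metis (no_types) mult.assoc of_nat_le_iff of_nat_mult)
  also have "m * ((2 * m) choose m) dvd Lcm {1..n}"
    by (rule binomial_mult_dvd_common_multiple) (use m in auto)
  hence "m * ((2 * m) choose m) \<le> Lcm {1..n}"
    by (rule dvd_imp_le) (rule Lcm_atLeastAtMost_pos)
  hence "2 * (m * ((2 * m) choose m)) \<le> 2 * Lcm {1..n}" by simp
  finally have "4 ^ m \<le> 2 * Lcm {1..n}" .
  moreover have "2 * 2 ^ (n - 2) \<le> (4::nat) ^ m"
  proof -
    have "2 * 2 ^ (n - 2) = (2::nat) ^ (n - 1)"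
      using assms by (metis Suc_1 Suc_diff_Suc Suc_le_lessD power_Suc)
    also have "\<dots> \<le> 2 ^ (2 * m)" using m by (intro power_increasing) auto
    also have "\<dots> = 4 ^ m" by (simp add: power_mult)
    finally show ?thesis .
  qed
  ultimately show ?thesis using Lcm_le_power_card_primes[of n] by linarith
qed

lemma card_primes_log_lower_bound:
  assumes "n \<ge> 2"
  shows "real n - 2 \<le> real (card {p::nat. prime p \<and> p \<le> n}) * log 2 (real n)"
proof -
  let ?c = "card {p::nat. prime p \<and> p \<le> n}"
  have "real (2 ^ (n - 2)) \<le> real (n ^ ?c)"
    using two_power_le_power_card_primes[OF assms] by (simp only: of_nat_le_iff)
  hence "log 2 (2 ^ (n - 2)) \<le> log 2 (real n ^ ?c)"
    using assms by (subst log_le_cancel_iff) auto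
  thus ?thesis using assms by (simp add: log_nat_power of_nat_diff)
qed

subsection \<open>Brun's pure sieve\<close>

lemma sum_subsets_by_card:
  fixes g :: "nat \<Rightarrow> real"
  assumes "finite Q"
  shows "(\<Sum>A | A \<subseteq> Q \<and> card A \<le> m. g (card A)) = (\<Sum>j\<le>m. real (card Q choose j) * g j)"
proof -
  let ?F = "{A. A \<subseteq> Q \<and> card A \<le> m}"
  have fin: "finite ?F" using assms by simp
  have "(\<Sum>A\<in>?F. g (card A)) = (\<Sum>j\<le>m. \<Sum>A | A \<in> ?F \<and> card A = j. g (card A))"
    by (rule sum.group[symmetric]) (use fin in auto)
  also have "\<dots> = (\<Sum>j\<le>m. real (card Q choose j) * g j)"
  proof (rule sum.cong)
    fix j assume "j \<in> {..m}"
    hence "{A. A \<in> ?F \<and> card A = j} = {A. A \<subseteq> Q \<and> card A = j}" by auto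
    then show "(\<Sum>A | A \<in> ?F \<and> card A = j. g (card A)) = real (card Q choose j) * g j"
      using n_subsets[OF assms, of j] by simp
  qed simp
  finally show ?thesis .
qed

text \<open>Inclusion-exclusion stopped at an odd level. For nonempty \<open>Q\<close> the truncated
  alternating row sum collapses to a single binomial coefficient with sign \<open>(-1) ^ m\<close>,
  hence is not positive.\<close>

lemma Bonferroni_odd:
  assumes "finite Q" "odd m"
  shows "(\<Sum>A | A \<subseteq> Q \<and> card A \<le> m. (-1) ^ card A) \<le> (of_bool (Q = {}) :: real)"
proof (cases "Q = {}")
  case True
  have "{A. A \<subseteq> Q \<and> card A \<le> m} = {{}}" using True by auto
  thus ?thesis using True by simp
next
  case False
  then obtain r where r: "card Q = Suc r" using assms(1) by (cases "card Q") auto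
  have "(\<Sum>A | A \<subseteq> Q \<and> card A \<le> m. (-1::real) ^ card A)
        = (\<Sum>j\<le>m. (real (card Q) gchoose j) * (-1) ^ j)"
    using sum_subsets_by_card[OF assms(1), of "\<lambda>j. (-1) ^ j" m] by (simp add: binomial_gbinomial)
  also have "\<dots> = - real (r choose m)"
    unfolding gbinomial_sum_lower_neg using assms(2) r by (simp add: binomial_gbinomial)
  finally show ?thesis using False by simp
qed

text \<open>Bounds the number of rounding errors in the sieve, by comparison with the binomial
  expansion of the right-hand side.\<close>

lemma card_small_subsets_le:
  assumes "finite P"
  shows "real (card {A. A \<subseteq> P \<and> card A \<le> m}) \<le> (real (card P) + 1) ^ m"
proof -
  have "real (card {A. A \<subseteq> P \<and> card A \<le> m}) = (\<Sum>j\<le>m. real (card P choose j))"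
    using sum_subsets_by_card[OF assms, of "\<lambda>_. 1" m] by simp
  also have "\<dots> \<le> (\<Sum>j\<le>m. real (m choose j) * real (card P) ^ j)"
  proof (rule sum_mono)
    fix j assume j: "j \<in> {..m}"
    have "real (card P choose j) \<le> real (card P) ^ j"
      by (metis binomial_le_pow of_nat_le_iff of_nat_power le_less_linear binomial_eq_0 zero_le)
    also have "\<dots> \<le> real (m choose j) * real (card P) ^ j"
      using j by (intro mult_right_le_one_le mult_le_cancel_right1[THEN iffD2]) (auto simp: Suc_le_eq)
    finally show "real (card P choose j) \<le> real (m choose j) * real (card P) ^ j" .
  qed
  also have "\<dots> = (real (card P) + 1) ^ m"
    using binomial_ring[of "real (card P)" 1 m] by (simp add: atLeast0AtMost add.commute)
  finally show ?thesis .
qed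

lemma card_multiples: 
  assumes "d > 0" shows "card {s \<in> {1..x}. d dvd s} = x div (d::nat)"
proof -
  have "{s \<in> {1..x}. d dvd s} = (\<lambda>i. d * i) ` {1..x div d}"
  proof (intro equalityI subsetI)
    fix s assume "s \<in> {s \<in> {1..x}. d dvd s}"
    then obtain i where i: "s = d * i" "1 \<le> s" "s \<le> x" by auto
    then have "i \<in> {1..x div d}" using assms
      by (auto simp: less_eq_div_iff_mult_less_eq mult.commute Suc_le_eq)
    thus "s \<in> (\<lambda>i. d * i) ` {1..x div d}" using i by auto
  next
    fix s assume "s \<in> (\<lambda>i. d * i) ` {1..x div d}"
    thus "s \<in> {s \<in> {1..x}. d dvd s}" using assms
      by (auto simp: less_eq_div_iff_mult_less_eq mult.commute Suc_le_eq)
  qed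
  also have "card \<dots> = x div d"
    using assms by (subst card_image) (auto simp: inj_on_def)
  finally show ?thesis .
qed

lemma prod_primes_dvd_iff:
  fixes A :: "nat set"
  assumes "finite A" "\<And>p. p \<in> A \<Longrightarrow> prime p"
  shows "\<Prod>A dvd s \<longleftrightarrow> (\<forall>p\<in>A. p dvd s)"
  using assms
proof (induction rule: finite_induct)
  case (insert p A)
  have "coprime p (\<Prod>A)"
    using insert.hyps insert.prems by (intro prod_coprime_right primes_coprime) auto
  then show ?case using insert by (auto intro: divides_mult dvd_mult_left dvd_mult_right)
qed simp

text \<open>Three contributions: the full Euler product as main term, the cost of omitting subsets
  with more than \<open>m\<close> primes, and a rounding error of at most 1 for each subset
  kept.\<close>

lemma pure_sieve_lower_bound:
  fixes P :: "nat set"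
  assumes "finite P" "\<And>p. p \<in> P \<Longrightarrow> prime p" "odd m"
  shows "real x * ((\<Prod>p\<in>P. 1 - 1 / real p) - (\<Prod>p\<in>P. 1 + 2 / real p) / 2 ^ m) - (real (card P) + 1) ^ m
         \<le> real (card {s \<in> {1..x}. \<forall>p\<in>P. \<not> p dvd s})"
proof -
  define F where "F = {A. A \<subseteq> P \<and> card A \<le> m}"
  define w where "w A = (-1) ^ card A / real (\<Prod>A)" for A :: "nat set"
  have fin: "finite F" "F \<subseteq> Pow P" using assms(1) by (auto simp: F_def)
  have pos: "\<Prod>A > 0" if "A \<subseteq> P" for A
    using that assms(2) by (intro prod_pos) (auto simp: prime_gt_0_nat)
  \<comment> \<open>A subset with more than \<open>m\<close> elements is weighted by \<open>2 ^ (card A - m) \<ge> 1\<close>.\<close>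
  have "(\<Prod>p\<in>P. 1 - 1 / real p) = (\<Sum>A\<in>Pow P. w A)"
    using prod_diff_conv_sum[OF assms(1), of "\<lambda>_. 1::real" "\<lambda>p. 1 / real p"]
    by (simp add: w_def prod_dividef)
  also have "\<dots> = (\<Sum>A\<in>F. w A) + (\<Sum>A\<in>Pow P - F. w A)"
    using fin assms(1) by (metis add.commute finite_Pow_iff sum.subset_diff)
  also have "(\<Sum>A\<in>Pow P - F. w A) \<le> (\<Sum>A\<in>Pow P - F. 2 ^ card A / real (\<Prod>A) / 2 ^ m)"
  proof (rule sum_mono)
    fix A assume A: "A \<in> Pow P - F"
    have "(-1) ^ card A \<le> (1 :: real)" by (cases "even (card A)") auto
    also have "1 \<le> (2::real) ^ card A / 2 ^ m"
      using A by (auto simp: F_def)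
    finally have "(-1) ^ card A / real (\<Prod>A) \<le> 2 ^ card A / 2 ^ m / real (\<Prod>A)"
      by (rule divide_right_mono) (simp add: prod_nonneg)
    thus "w A \<le> 2 ^ card A / real (\<Prod>A) / 2 ^ m"
      unfolding w_def by (simp add: mult.commute)
  qed
  \<comment> \<open>The added terms are nonnegative, and the sum over all subsets factors into a
    product over \<open>P\<close>.\<close>
  also have "\<dots> \<le> (\<Sum>A\<in>Pow P. 2 ^ card A / real (\<Prod>A) / 2 ^ m)"
    using assms(1) by (intro sum_mono2) (auto intro!: divide_nonneg_nonneg mult_nonneg_nonneg prod_nonneg)
  also have "\<dots> = (\<Prod>p\<in>P. 1 + 2 / real p) / 2 ^ m"
  proof -
    have "(\<Prod>p\<in>P. 2 / real p + 1) = (\<Sum>A\<in>Pow P. 2 ^ card A / real (\<Prod>A))"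
      using assms(1) by (simp add: prod_add prod_dividef)
    thus ?thesis by (simp add: sum_divide_distrib add.commute)
  qed
  finally have main: "(\<Prod>p\<in>P. 1 - 1 / real p) - (\<Prod>p\<in>P. 1 + 2 / real p) / 2 ^ m \<le> (\<Sum>A\<in>F. w A)"
    by simp
  have "real x * ((\<Prod>p\<in>P. 1 - 1 / real p) - (\<Prod>p\<in>P. 1 + 2 / real p) / 2 ^ m)
        \<le> real x * (\<Sum>A\<in>F. w A)"
    using main by (intro mult_left_mono) auto
  \<comment> \<open>Replacing the quotient by its floor costs at most 1 for even
    \<open>card A\<close>; for odd \<open>card A\<close> the floor already errs in the right
    direction.\<close>
  also have "\<dots> \<le> (\<Sum>A\<in>F. (-1) ^ card A * real (x div \<Prod>A) + 1)"
    unfolding sum_distrib_left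
  proof (rule sum_mono)
    fix A assume A: "A \<in> F"
    have "real (x div \<Prod>A) \<le> real x / real (\<Prod>A)" by (rule of_nat_div_le_of_nat)
    moreover have "real x / real (\<Prod>A) \<le> real (x div \<Prod>A) + 1"
      using floor_divide_of_nat_eq[of x "\<Prod>A", where ?'a = real] by linarith
    ultimately show "real x * w A \<le> (-1) ^ card A * real (x div \<Prod>A) + 1"
      unfolding w_def by (cases "even (card A)") auto
  qed
  also have "\<dots> = (\<Sum>A\<in>F. (-1) ^ card A * real (x div \<Prod>A)) + real (card F)"
    by (simp add: sum.distrib)
  also have "(\<Sum>A\<in>F. (-1) ^ card A * real (x div \<Prod>A))
             = (\<Sum>A\<in>F. \<Sum>s\<in>{1..x}. if \<Prod>A dvd s then (-1) ^ card A else 0)"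
  proof (rule sum.cong)
    fix A assume A: "A \<in> F"
    have "(\<Sum>s\<in>{1..x}. if \<Prod>A dvd s then (-1) ^ card A else 0)
          = (-1) ^ card A * real (card {s \<in> {1..x}. \<Prod>A dvd s})"
      by (simp add: sum.inter_filter[symmetric])
    thus "(-1) ^ card A * real (x div \<Prod>A) = (\<Sum>s\<in>{1..x}. if \<Prod>A dvd s then (-1) ^ card A else 0)"
      using card_multiples[of "\<Prod>A" x] pos[of A] A by (simp add: F_def)
  qed simp
  \<comment> \<open>After the swap, the inner sum for fixed \<open>s\<close> runs over small sets of
    sieving primes dividing \<open>s\<close>, which is the situation of
    \<open>Bonferroni_odd\<close>.\<close>
  also have "\<dots> = (\<Sum>s\<in>{1..x}. \<Sum>A\<in>F. if \<Prod>A dvd s then (-1) ^ card A else 0)"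
    by (rule sum.swap)
  also have "\<dots> \<le> (\<Sum>s\<in>{1..x}. of_bool ({p\<in>P. p dvd s} = {}))"
  proof (rule sum_mono)
    fix s assume "s \<in> {1..x}"
    have "(\<Sum>A\<in>F. if \<Prod>A dvd s then (-1) ^ card A else (0::real))
          = (\<Sum>A | A \<in> F \<and> \<Prod>A dvd s. (-1) ^ card A)"
      using fin by (simp add: sum.inter_filter)
    also have "{A. A \<in> F \<and> \<Prod>A dvd s} = {A. A \<subseteq> {p\<in>P. p dvd s} \<and> card A \<le> m}"
    proof -
      have "\<Prod>A dvd s \<longleftrightarrow> (\<forall>p\<in>A. p dvd s)" if "A \<subseteq> P" for A
        using that assms by (intro prod_primes_dvd_iff) (auto intro: finite_subset)
      thus ?thesis by (auto simp: F_def)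
    qed
    also have "(\<Sum>A | A \<subseteq> {p\<in>P. p dvd s} \<and> card A \<le> m. (-1) ^ card A)
               \<le> (of_bool ({p\<in>P. p dvd s} = {}) :: real)"
      by (rule Bonferroni_odd) (use assms in auto)
    finally show "(\<Sum>A\<in>F. if \<Prod>A dvd s then (-1) ^ card A else 0)
                  \<le> (of_bool ({p\<in>P. p dvd s} = {}) :: real)" .
  qed
  also have "\<dots> = real (card {s \<in> {1..x}. \<forall>p\<in>P. \<not> p dvd s})"
  proof -
    have eq: "{1..x} \<inter> {s. {p\<in>P. p dvd s} = {}} = {s \<in> {1..x}. \<forall>p\<in>P. \<not> p dvd s}" by auto
    have "(\<Sum>s\<in>{1..x}. of_bool ({p\<in>P. p dvd s} = {}))
        = real (card ({1..x} \<inter> {s. {p\<in>P. p dvd s} = {}}))"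
      by (intro sum_of_bool_eq finite_atLeastAtMost)
    then show ?thesis unfolding eq .
  qed
  also have "real (card F) \<le> (real (card P) + 1) ^ m"
    unfolding F_def by (rule card_small_subsets_le) (rule assms(1))
  finally show ?thesis by (simp only: diff_le_eq)
qed

section \<open>Euler products over the primes below \<open>k\<close>\<close>

lemma primes_less_Suc:
  "{p::nat. prime p \<and> p < Suc k} = (if prime k then insert k {p. prime p \<and> p < k} else {p. prime p \<and> p < k})"
  by (auto simp: less_Suc_eq)

text \<open>Allowing a factor for every integer and not only for primes suffices, since
  \<open>1 + 2 / k\<close> is at most the square of \<open>(k + 1) / k\<close>, which
  telescopes.\<close>

lemma prod_primes_one_plus_le:
  assumes "k \<ge> 1"
  shows "(\<Prod>p | prime p \<and> p < k. 1 + 2 / real p) \<le> (real k)\<^sup>2"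
  using assms
proof (induction k rule: nat_induct_at_least)
  case base
  have "{p::nat. prime p \<and> p < 1} = {}" by auto
  then show ?case by simp
next
  case (Suc k)
  let ?G = "\<Prod>p | prime p \<and> p < k. 1 + 2 / real p"
  have "(\<Prod>p | prime p \<and> p < Suc k. 1 + 2 / real p) \<le> (1 + 2 / real k) * ?G"
  proof (cases "prime k")
    case True
    then show ?thesis by (simp add: primes_less_Suc)
  next
    case False
    have "?G \<ge> 0" by (intro prod_nonneg) auto
    then show ?thesis using False by (simp add: primes_less_Suc algebra_simps)
  qed
  also have "\<dots> \<le> (1 + 2 / real k) * (real k)\<^sup>2"
    using Suc by (intro mult_left_mono) auto
  also have "\<dots> \<le> (real (Suc k))\<^sup>2"
    using Suc.hyps by (simp add: field_simps power2_eq_square)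
  finally show ?case .
qed

text \<open>
  Bounding the primes by all odd numbers loses only a square root, because
  \<open>(2 j / (2 j + 1))\<^sup>2 \<ge> (2 j - 1) / (2 j + 1)\<close>.
\<close>

lemma prod_primes_one_minus_ge_even:
  assumes "j \<ge> 1"
  shows "(\<Prod>p | prime p \<and> p < 2 * j + 2. 1 - 1 / real p) \<ge> 1 / (2 * sqrt (real (2 * j + 1)))"
  using assms
proof (induction j rule: nat_induct_at_least)
  case base
  have "{p::nat. prime p \<and> p < 2 * 1 + 2} = {2, 3}"
  proof -
    have "p = 2 \<or> p = 3" if "prime p" "p < 4" for p :: nat
      using prime_ge_2_nat[OF that(1)] that(2) by auto
    thus ?thesis by auto
  qed
  moreover have "3 / 2 \<le> sqrt (3::real)" by (rule real_le_rsqrt) (simp add: power2_eq_square)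
  ultimately show ?case by (simp add: field_simps)
next
  case (Suc j)
  let ?G = "\<lambda>k. \<Prod>p | prime p \<and> p < k. 1 - 1 / real p"
  let ?y = "real (2 * j + 1)"
  have pos: "?G k \<ge> 0" for k by (intro prod_nonneg) (auto dest: prime_gt_0_nat)
  have e: "2 * Suc j + 2 = Suc (Suc (2 * j + 2))" by simp
  \<comment> \<open>Passing from \<open>j\<close> to \<open>Suc j\<close> admits the candidates
    \<open>2 * j + 2\<close> and \<open>2 * j + 3\<close>; the first is even and exceeds 2, so only
    the odd one can add a factor.\<close>
  have "\<not> prime (2 * j + 2)"
    using prime_odd_nat[of "2 * j + 2"] Suc.hyps by auto
  hence G: "?G (Suc (2 * j + 2)) = ?G (2 * j + 2)"
    by (subst primes_less_Suc) simp
  have sq: "(2 * j + 2) / (2 * j + 3) / sqrt ?y \<ge> 1 / sqrt (real (2 * j + 3))"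
  proof -
    have "?y * real (2 * j + 3) \<le> (real (2 * j + 2))\<^sup>2"
      by (simp add: power2_eq_square algebra_simps)
    hence "sqrt (?y * real (2 * j + 3)) \<le> real (2 * j + 2)"
      by (intro real_le_lsqrt) auto
    hence "(sqrt ?y * sqrt (real (2 * j + 3))) * sqrt (real (2 * j + 3))
           \<le> real (2 * j + 2) * sqrt (real (2 * j + 3))"
      unfolding real_sqrt_mult by (rule mult_right_mono) simp
    thus ?thesis by (simp add: divide_simps mult_ac)
  qed
  have "1 - 1 / real (2 * j + 3) = (2 * j + 2) / (2 * j + 3)" by (simp add: field_simps)
  moreover have "2 * Suc j + 1 = 2 * j + 3" by simp
  ultimately have "1 / (2 * sqrt (real (2 * Suc j + 1))) \<le> (1 - 1 / real (2 * j + 3)) * (1 / (2 * sqrt ?y))"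
    using divide_right_mono[OF sq, of 2] by (simp add: mult_ac add_ac)
  also have "\<dots> \<le> (1 - 1 / real (2 * j + 3)) * ?G (2 * j + 2)"
    using Suc.IH by (intro mult_left_mono) auto
  also have "\<dots> \<le> ?G (Suc (Suc (2 * j + 2)))"
  proof (cases "prime (2 * j + 3)")
    case True
    hence "prime (Suc (2 * j + 2))" by (simp add: eval_nat_numeral)
    then show ?thesis
      by (subst primes_less_Suc[of "Suc (2 * j + 2)"]) (use G in \<open>simp add: eval_nat_numeral\<close>)
  next
    case False
    hence "\<not> prime (Suc (2 * j + 2))" by (simp add: eval_nat_numeral)
    hence "?G (Suc (Suc (2 * j + 2))) = ?G (2 * j + 2)"
      by (subst primes_less_Suc) (simp only: G if_False)
    then show ?thesis using pos[of "2 * j + 2"] by (simp add: mult_left_le_one_le)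
  qed
  finally show ?case unfolding e .
qed

lemma prod_primes_one_minus_ge:
  assumes "k \<ge> 4"
  shows "(\<Prod>p | prime p \<and> p < k. 1 - 1 / real p) \<ge> 1 / (2 * sqrt (real k))"
proof -
  define j where "j = (k - 2) div 2"
  have j: "j \<ge> 1" "k = 2 * j + 2 \<or> k = Suc (2 * j + 2)" using assms by (auto simp: j_def)
  have "\<not> prime (2 * j + 2)" using prime_odd_nat[of "2 * j + 2"] j by auto
  hence "{p. prime p \<and> p < k} = {p. prime p \<and> p < 2 * j + 2}"
    using j(2) primes_less_Suc[of "2 * j + 2"] by metis
  moreover have "1 / (2 * sqrt (real k)) \<le> 1 / (2 * sqrt (real (2 * j + 1)))"
    using j by (intro divide_left_mono mult_left_mono) auto
  ultimately show ?thesis using prod_primes_one_minus_ge_even[OF j(1)] by simp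
qed

subsection \<open>Progressions with rough differences\<close>

text \<open>Coprimality to every \<open>j\<close> below \<open>k\<close> is the form that lets
  multipliers be cancelled; the sieve uses the equivalent condition on prime divisors.\<close>

definition rough_upto :: "nat \<Rightarrow> nat \<Rightarrow> nat set" where
  "rough_upto k x = {s \<in> {1..x}. \<forall>j\<in>{1..<k}. coprime j s}"

text \<open>Since \<open>m\<close> is coprime to \<open>d'\<close> and \<open>m'\<close> to
  \<open>d\<close>, the equation forces \<open>m\<close> and \<open>m'\<close> to divide each other.
  This recovers the common difference from the distance of a monochromatic pair.\<close>

lemma rough_times_small_unique:
  assumes "d \<in> rough_upto k x" "d' \<in> rough_upto k x'"
  assumes "m \<in> {1..<k}" "m' \<in> {1..<k}" "m * d = m' * d'"
  shows "d = d'"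
proof -
  have "m dvd m' * d'" using assms(5) by (metis dvd_triv_left)
  moreover have "coprime m d'" using assms by (auto simp: rough_upto_def)
  ultimately have "m dvd m'" by (simp add: coprime_dvd_mult_left_iff)
  have "m' dvd m * d" using assms(5) by (metis dvd_triv_left)
  moreover have "coprime m' d" using assms by (auto simp: rough_upto_def)
  ultimately have "m' dvd m" by (simp add: coprime_dvd_mult_left_iff)
  with \<open>m dvd m'\<close> have "m = m'" by (rule dvd_antisym)
  then show ?thesis using assms by auto
qed

lemma card_monochromatic_pairs_le:
  assumes "equinumerous_coloring t n c"
  shows "finite {(u, v). u \<in> {1..t * n} \<and> v \<in> {1..t * n} \<and> c u = c v}" (is "finite ?M")
    and "card {(u, v). u \<in> {1..t * n} \<and> v \<in> {1..t * n} \<and> c u = c v} \<le> t * (n * n)"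
proof -
  define K where "K i = {x \<in> {1..t * n}. c x = i}" for i
  have sub: "?M \<subseteq> (\<Union>i\<in>{1..t}. K i \<times> K i)"
    using assms by (fastforce simp: equinumerous_coloring_def K_def Pi_def)
  have fin: "finite (\<Union>i\<in>{1..t}. K i \<times> K i)" by (auto simp: K_def)
  show "finite ?M" using sub fin by (rule finite_subset)
  have "card ?M \<le> card (\<Union>i\<in>{1..t}. K i \<times> K i)" using fin sub by (rule card_mono)
  also have "\<dots> \<le> (\<Sum>i\<in>{1..t}. card (K i \<times> K i))" by (rule card_UN_le) simp
  also have "\<dots> = (\<Sum>i\<in>{1..t}. n * n)"
    using assms by (intro sum.cong) (auto simp: equinumerous_coloring_def K_def card_cartesian_product)
  finally show "card ?M \<le> t * (n * n)" by simp
qed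

text \<open>Double counting: every progression with start in the first half and rough difference is
  sent injectively to the position of one term together with a monochromatic pair. There are
  \<open>k\<close> positions, and \<open>n * n\<close> ordered pairs in each of the \<open>t\<close>
  colors.\<close>

lemma rainbow_free_imp_few_rough_differences:
  assumes col: "equinumerous_coloring t n c"
    and free: "\<And>A. is_AP k A \<Longrightarrow> A \<subseteq> {1..t * n} \<Longrightarrow> \<not> rainbow c A"
  shows "(t * n div 2) * card (rough_upto k (t * n div (2 * k))) \<le> k * (t * (n * n))"
proof -
  define N where "N = t * n"
  define R where "R = rough_upto k (N div (2 * k))"
  define M where "M = {(u, v). u \<in> {1..N} \<and> v \<in> {1..N} \<and> c u = c v}"
  let ?X = "{1..N div 2} \<times> R"
  \<comment> \<open>The start uses at most half of the interval, and \<open>k\<close> steps of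
    length at most \<open>N div (2 * k)\<close> use at most the other half.\<close>
  have bound: "a + i * d \<in> {1..N}" if "(a, d) \<in> ?X" "i < k" for a d i
  proof -
    have "i * d \<le> k * (N div (2 * k))"
      using that by (intro mult_le_mono) (auto simp: R_def rough_upto_def)
    moreover have "2 * k * (N div (2 * k)) \<le> N" by (rule times_div_less_eq_dividend)
    ultimately have "a + i * d \<le> N" using that(1) unfolding mult.assoc by auto
    then show ?thesis using that(1) by auto
  qed
  have "\<exists>p. fst p < snd p \<and> snd p < k \<and> c (fst z + fst p * snd z) = c (fst z + snd p * snd z)"
    if z: "z \<in> ?X" for z
  proof -
    obtain a d where ad: "z = (a, d)" by force
    have d: "d \<ge> 1" using z ad by (auto simp: R_def rough_upto_def)
    let ?A = "(\<lambda>i. a + i * d) ` {..<k}"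
    have "is_AP k ?A" using d by (auto simp: is_AP_def)
    moreover have "?A \<subseteq> {1..t * n}" using bound z ad unfolding N_def by blast
    ultimately have "\<not> inj_on c ?A" using free by (simp add: rainbow_def)
    then obtain i j where ij: "i < k" "j < k" "i \<noteq> j" "c (a + i * d) = c (a + j * d)"
      by (auto simp: inj_on_def)
    show ?thesis
    proof (cases "i < j")
      case True
      then show ?thesis using ij ad by (intro exI[of _ "(i, j)"]) auto
    next
      case False
      then show ?thesis using ij ad by (intro exI[of _ "(j, i)"]) auto
    qed
  qed
  then obtain p where p: "\<And>z. z \<in> ?X \<Longrightarrow> fst (p z) < snd (p z) \<and> snd (p z) < k \<and>
      c (fst z + fst (p z) * snd z) = c (fst z + snd (p z) * snd z)"
    by metis
  \<comment> \<open>The pair determines \<open>d\<close> by roughness; the recorded index of its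
    first term then determines the start.\<close>
  define f where "f z = (fst (p z), fst z + fst (p z) * snd z, fst z + snd (p z) * snd z)" for z
  have "inj_on f ?X"
  proof (rule inj_onI)
    fix z z' assume z: "z \<in> ?X" "z' \<in> ?X" and eq: "f z = f z'"
    obtain a d where ad: "z = (a, d)" by force
    obtain a' d' where ad': "z' = (a', d')" by force
    obtain i j where ij: "p z = (i, j)" by force
    obtain j' where ij': "p z' = (i, j')" using eq by (cases "p z'") (auto simp: f_def ij)
    have lt: "i < j" "j < k" "i < j'" "j' < k" using p[OF z(1)] p[OF z(2)] ij ij' by auto
    have e: "a + i * d = a' + i * d'" "a + j * d = a' + j' * d'"
      using eq ij ij' by (simp_all add: f_def ad ad')
    have "(j - i) * d = j * d - i * d" "(j' - i) * d' = j' * d' - i * d'"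
      by (simp_all only: diff_mult_distrib)
    hence "(j - i) * d = (j' - i) * d'" using e by arith
    moreover have "d \<in> rough_upto k (N div (2 * k))" "d' \<in> rough_upto k (N div (2 * k))"
      using z ad ad' by (auto simp: R_def)
    ultimately have "d = d'"
      using lt by (intro rough_times_small_unique[of d k _ d' _ "j - i" "j' - i"]) auto
    then show "z = z'" using e ad ad' by simp
  qed
  moreover have "f ` ?X \<subseteq> {..<k} \<times> M"
  proof
    fix y assume "y \<in> f ` ?X"
    then obtain a d where z: "(a, d) \<in> ?X" "y = f (a, d)" by auto
    show "y \<in> {..<k} \<times> M"
      using p[OF z(1)] bound[OF z(1), of "fst (p (a, d))"] bound[OF z(1), of "snd (p (a, d))"]
      by (auto simp: z(2) f_def M_def)
  qed
  moreover have "finite M" "card M \<le> t * (n * n)"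
    using card_monochromatic_pairs_le[OF col] by (simp_all add: M_def N_def)
  ultimately have "card ?X \<le> card ({..<k} \<times> M)" by (intro card_inj_on_le) auto
  also have "\<dots> \<le> k * (t * (n * n))"
    using \<open>card M \<le> _\<close> by (simp add: card_cartesian_product)
  finally show ?thesis by (simp add: card_cartesian_product R_def N_def)
qed

subsection \<open>Density of rough numbers\<close>

lemma coprime_range_iff_no_prime_factor:
  "(\<forall>j\<in>{1..<k}. coprime j s) \<longleftrightarrow> (\<forall>p\<in>{p. prime p \<and> p < k}. \<not> p dvd s)" for s :: nat
proof safe
  fix p assume "\<forall>j\<in>{1..<k}. coprime j s" "prime p" "p < k" "p dvd s"
  then show False
    using prime_gt_1_nat[of p] by (auto dest!: bspec[of _ _ p] simp: coprime_absorb_left)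
next
  fix j assume *: "\<forall>p\<in>{p. prime p \<and> p < k}. \<not> p dvd s" and j: "j \<in> {1..<k}"
  show "coprime j s"
  proof (rule ccontr)
    assume "\<not> coprime j s"
    then obtain p where p: "prime p" "p dvd j" "p dvd s"
      by (metis coprime_iff_gcd_eq_1 gcd_greatest_iff prime_factor_nat)
    then have "p < k" using j by (auto dest!: dvd_imp_le)
    then show False using * p by auto
  qed
qed

text \<open>In units of \<open>x / sqrt k\<close>, the Euler product gives at least 1/2. The third
  hypothesis keeps the truncation cost below 1/8, the fourth does so for the rounding errors, and
  1/4 remains.\<close>

lemma card_rough_ge_sieve:
  assumes "k \<ge> 8" "odd m" "8 * k ^ 3 \<le> 2 ^ m" "k ^ (m + 2) \<le> x"
  shows "real x / (4 * sqrt (real k)) \<le> real (card (rough_upto k x))"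
proof -
  define P where "P = {p. prime p \<and> p < k}"
  have k: "real k > 0" using assms by simp
  have sqk: "sqrt (real k) \<le> real k" 
    using assms by (intro real_le_lsqrt) (auto simp: power2_eq_square)
  have tail: "(\<Prod>p\<in>P. 1 + 2 / real p) / 2 ^ m \<le> 1 / (8 * sqrt (real k))"
  proof -
    have "(\<Prod>p\<in>P. 1 + 2 / real p) / 2 ^ m \<le> (real k)\<^sup>2 / 2 ^ m"
      unfolding P_def using prod_primes_one_plus_le[of k] assms
      by (intro divide_right_mono) auto
    also have "\<dots> \<le> (real k)\<^sup>2 / (8 * real k ^ 3)"
    proof -
      have "real (8 * k ^ 3) \<le> real (2 ^ m)" using assms(3) by (simp only: of_nat_le_iff)
      thus ?thesis using k by (intro divide_left_mono) auto
    qed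
    also have "\<dots> = 1 / (8 * real k)" using k by (simp add: field_simps eval_nat_numeral)
    also have "\<dots> \<le> 1 / (8 * sqrt (real k))"
      using sqk k by (intro divide_left_mono) auto
    finally show ?thesis .
  qed
  have error: "(real (card P) + 1) ^ m \<le> real x / (8 * sqrt (real k))"
  proof -
    have "P \<subseteq> {2..<k}" by (auto simp: P_def prime_ge_2_nat)
    hence "card P \<le> k - 2" using card_mono[of "{2..<k}" P] by simp
    hence "real (card P) + 1 \<le> real k" using assms(1) by linarith
    hence base: "(real (card P) + 1) ^ m \<le> real k ^ m" by (intro power_mono) auto
    have "real k ^ m * (8 * sqrt (real k)) \<le> real k ^ m * (real k * real k)"
      using assms(1) sqk by (intro mult_left_mono mult_mono) auto
    hence "real k ^ m * (8 * sqrt (real k)) \<le> real (k ^ (m + 2))"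
      by (simp add: power_add power2_eq_square mult_ac)
    also have "\<dots> \<le> real x" using assms(4) by (simp only: of_nat_le_iff)
    finally have "real k ^ m \<le> real x / (8 * sqrt (real k))"
      using k by (simp add: pos_le_divide_eq)
    with base show ?thesis by (rule order_trans)
  qed
  have "real x / (4 * sqrt (real k))
        = real x * (1 / (2 * sqrt (real k)) - 1 / (8 * sqrt (real k))) - real x / (8 * sqrt (real k))"
    using k by (simp add: field_simps)
  also have "\<dots> \<le> real x * ((\<Prod>p\<in>P. 1 - 1 / real p) - (\<Prod>p\<in>P. 1 + 2 / real p) / 2 ^ m)
                  - (real (card P) + 1) ^ m"
    using prod_primes_one_minus_ge[of k] assms(1) tail error
    by (intro diff_mono mult_left_mono) (auto simp: P_def)
  also have "\<dots> \<le> real (card {s \<in> {1..x}. \<forall>p\<in>P. \<not> p dvd s})"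
    by (rule pure_sieve_lower_bound) (use assms(2) in \<open>auto simp: P_def\<close>)
  also have "{s \<in> {1..x}. \<forall>p\<in>P. \<not> p dvd s} = rough_upto k x"
    unfolding rough_upto_def coprime_range_iff_no_prime_factor P_def ..
  finally show ?thesis .
qed

text \<open>A prime that is at least \<open>k\<close> has no prime divisor below \<open>k\<close>,
  so Chebyshev's count applies after discarding fewer than \<open>k\<close> primes.\<close>

lemma card_rough_ge_primes:
  assumes "x \<ge> 2"
  shows "(real x - 2) / log 2 (real x) - real k \<le> real (card (rough_upto k x))"
proof -
  let ?Q = "{p::nat. prime p \<and> p \<le> x}"
  have "?Q \<subseteq> rough_upto k x \<union> {1..<k}"
  proof
    fix p assume p: "p \<in> ?Q"
    hence "p \<ge> 1" using prime_ge_1_nat by blast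
    moreover have "\<forall>q\<in>{q. prime q \<and> q < k}. \<not> q dvd p" if "p \<ge> k"
      using that p by (auto dest: primes_dvd_imp_eq)
    ultimately show "p \<in> rough_upto k x \<union> {1..<k}"
      using p unfolding rough_upto_def coprime_range_iff_no_prime_factor by force
  qed
  moreover have "finite (rough_upto k x)" by (simp add: rough_upto_def)
  ultimately have "card ?Q \<le> card (rough_upto k x) + card {1..<k}"
    by (meson card_Un_le card_mono finite_Un finite_atLeastLessThan order_trans)
  hence "real (card ?Q) \<le> real (card (rough_upto k x)) + real k"
    by simp
  moreover have "(real x - 2) / log 2 (real x) \<le> real (card ?Q)"
    using card_primes_log_lower_bound[OF assms] assms
    by (simp add: pos_divide_le_eq)
  ultimately show ?thesis by simp
qed

lemma eventually_card_rough_ge: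
  "\<forall>\<^sub>F k in sequentially. \<forall>x. real k * sqrt (real k) \<le> real x \<longrightarrow>
     real x / (4 * sqrt (real k)) \<le> real (card (rough_upto k x))"
proof -
  \<comment> \<open>With \<open>L\<close> the bound for \<open>log 2 x\<close> in the prime range,
    this says \<open>5 / (4 * sqrt k) <= 1 / (2 * L)\<close>: the target
    \<open>x / (4 * sqrt k)\<close> plus a loss of \<open>x / sqrt k\<close> fits into
    \<open>x / (2 * L)\<close>.\<close>
  have "\<forall>\<^sub>F k::nat in sequentially.
      5 * ((8 + 3 * log 2 (real k)) * log 2 (real k)) \<le> 2 * sqrt (real k)"
    by real_asymp
  thus ?thesis
    using eventually_ge_at_top[of 8]
  proof eventually_elim
    case (elim k)
    define l where "l = log 2 (real k)"
    define L where "L = (8 + 3 * l) * l"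
    have k: "real k \<ge> 8" using elim by simp
    have l: "l > 0" using k by (simp add: l_def)
    have L: "L > 0" using l by (simp add: L_def)
    have sq: "sqrt (real k) > 0" using k by simp
    \<comment> \<open>\<open>m\<close> is the least odd level with
      \<open>8 * k ^ 3 <= 2 ^ m\<close>; it grows like \<open>3 * log 2 k\<close>. The threshold
      \<open>k ^ (m + 2)\<close> separates the sieve range from the prime range.\<close>
    define m0 where "m0 = nat \<lceil>log 2 (8 * real k ^ 3)\<rceil>"
    define m where "m = (if odd m0 then m0 else m0 + 1)"
    have log8: "log 2 (8 * real k ^ 3) = 3 + 3 * l"
    proof -
      have "log 2 (8 * real k ^ 3) = log 2 (2 ^ 3) + log 2 (real k ^ 3)"
        using k log_mult[of 2 "2 ^ 3" "real k ^ 3"] by simp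
      also have "\<dots> = 3 + 3 * l" using k by (simp only: log_nat_power) (simp add: l_def)
      finally show ?thesis .
    qed
    have m: "odd m" "real m \<ge> 3 + 3 * l" "real m \<le> 5 + 3 * l"
      using l unfolding m_def m0_def log8 by (auto; linarith)+
    have "8 * real k ^ 3 = 2 powr (3 + 3 * l)"
      unfolding log8[symmetric] using k by simp
    also have "\<dots> \<le> 2 powr real m" using m by (intro powr_mono) auto
    also have "\<dots> = 2 ^ m" by (simp add: powr_realpow)
    finally have "real (8 * k ^ 3) \<le> real (2 ^ m)" by simp
    hence pm: "8 * k ^ 3 \<le> 2 ^ m" by (simp only: of_nat_le_iff)
    show ?case
    proof (intro allI impI)
      fix x assume x: "real k * sqrt (real k) \<le> real x"
      show "real x / (4 * sqrt (real k)) \<le> real (card (rough_upto k x))"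
      proof (cases "k ^ (m + 2) \<le> x")
        case True
        then show ?thesis using card_rough_ge_sieve[OF _ m(1) pm] elim by simp
      next
        case False
        have "1 \<le> sqrt (real k)" using k by simp
        hence "real k * 1 \<le> real k * sqrt (real k)" by (intro mult_left_mono) auto
        hence x8: "real x \<ge> 8" using x k by linarith
        have "real x \<le> real (k ^ (m + 2))" using False by (simp only: of_nat_le_iff)
        hence "log 2 (real x) \<le> log 2 (real k ^ (m + 2))"
          using x8 k by (subst log_le_cancel_iff) auto
        also have "\<dots> = real (m + 2) * l" using k by (subst log_nat_power) (auto simp: l_def)
        also have "\<dots> \<le> L" unfolding L_def using m l by (intro mult_right_mono) auto
        finally have logx: "log 2 (real x) \<le> L" .
        have "5 * L \<le> 2 * sqrt (real k)" using elim by (simp add: L_def l_def)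
        hence "5 / (4 * sqrt (real k)) \<le> 1 / (2 * L)"
          using L sq by (simp add: field_simps)
        hence "real x * (5 / (4 * sqrt (real k))) \<le> real x * (1 / (2 * L))"
          by (intro mult_left_mono) auto
        \<comment> \<open>The lower limit \<open>k * sqrt k\<close> on \<open>x\<close> is what
          absorbs the discarded primes below \<open>k\<close>.\<close>
        moreover have "real k \<le> real x / sqrt (real k)" using x sq by (simp add: field_simps)
        ultimately have "real x / (4 * sqrt (real k)) \<le> real x / (2 * L) - real k"
          by (simp add: field_simps)
        also have "real x / (2 * L) \<le> (real x - 2) / L"
          using L x8 by (simp add: field_simps)
        also have "\<dots> \<le> (real x - 2) / log 2 (real x)"
          using logx x8 L by (intro divide_left_mono mult_pos_pos) auto
        also have "\<dots> - real k \<le> real (card (rough_upto k x))"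
          using x8 by (intro card_rough_ge_primes) auto
        finally show ?thesis by simp
      qed
    qed
  qed
qed

section \<open>From the density of rough differences to the bound on \<open>T\<close>\<close>

lemma forces_rainbow_AP_if_large:
  assumes rough: "\<And>x. real k * sqrt (real k) \<le> real x \<Longrightarrow>
      real x / (4 * sqrt (real k)) \<le> real (card (rough_upto k x))"
    and k: "k \<ge> 1" and t: "real t \<ge> 49 * ((real k)\<^sup>2 * sqrt (real k))"
  shows "forces_rainbow_AP k t"
  unfolding forces_rainbow_AP_def
proof (intro allI impI)
  fix n c assume n: "n \<ge> 1" and col: "equinumerous_coloring t n c"
  define s where "s = sqrt (real k)"
  have s: "s \<ge> 1" "real k = s * s" using k by (auto simp: s_def)
  show "\<exists>A. is_AP k A \<and> A \<subseteq> {1..t * n} \<and> rainbow c A"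
  proof (rule ccontr)
    assume "\<not> ?thesis"
    hence few: "(t * n div 2) * card (rough_upto k (t * n div (2 * k))) \<le> k * (t * (n * n))"
      by (intro rainbow_free_imp_few_rough_differences[OF col]) auto
    define N where "N = t * n"
    define x where "x = N div (2 * k)"
    have "real t * 1 \<le> real t * real n" using n by (intro mult_left_mono) auto
    hence tN: "real t \<le> real N" by (simp add: N_def)
    have "1 * s \<le> s * s" using s by (intro mult_right_mono) auto
    hence ks: "1 \<le> s * s" "s \<le> s * s" using s(1) by linarith+
    have t': "real t \<ge> 49 * (real k * real k * s)"
      using t by (simp add: s_def power2_eq_square)
    have kk: "real k \<le> real k * real k * s"
    proof -
      have "1 * 1 \<le> real k * s" using s(1) k by (intro mult_mono) auto
      hence "real k * 1 \<le> real k * (real k * s)" by (intro mult_left_mono) auto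
      thus ?thesis by (simp add: mult.assoc)
    qed
    have N: "real N \<ge> 49 * real k" using tN t' kk by linarith
    have N2: "real N \<le> 3 * real (N div 2)"
    proof -
      have "N \<le> 2 * (N div 2) + 1" by simp
      moreover have "N \<ge> 4" using N k by linarith
      ultimately show ?thesis by linarith
    qed
    \<comment> \<open>Rounding in \<open>x\<close> loses less than \<open>2 * k\<close>, which is
      small against \<open>N >= 49 * k\<close>; hence the factor 4 below.\<close>
    have "N < 2 * k * (x + 1)"
      unfolding x_def using k by (metis add.commute div_less_iff_less_mult less_add_one mult.commute mult_pos_pos zero_less_numeral less_le_trans zero_less_one)
    hence "real N \<le> real (2 * k * (x + 1))" by (simp only: of_nat_le_iff)
    hence "real N \<le> 2 * (real k * real x) + 2 * real k" by (simp add: algebra_simps)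
    hence x: "real N \<le> 4 * (real k * real x)" using N by linarith
    have "49 * (real k * real k * s) \<le> 4 * (real k * real x)"
      using x tN t' by linarith
    hence "real k * (49 * (real k * s)) \<le> real k * (4 * real x)" by (simp add: mult_ac)
    hence "49 * (real k * s) \<le> 4 * real x" using k by (subst (asm) mult_le_cancel_left_pos) auto
    moreover have "real k * s \<ge> 0" using s by simp
    ultimately have "real k * sqrt (real k) \<le> real x" unfolding s_def by linarith
    from rough[OF this] have R: "real x / (4 * s) \<le> real (card (rough_upto k x))"
      by (simp add: s_def)
    \<comment> \<open>The factor 16 is 4 from \<open>N <= 4 * k * x\<close> times 4 from the density
      bound. With the 3 from halving \<open>N\<close>, the count yields
      \<open>t <= 48 * k * k * s\<close>, contradicting the constant 49.\<close>
    have "real N * (real N / (16 * real k * s)) \<le> real N * (real x / (4 * s))"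
      using x s k by (intro mult_left_mono) (auto simp: field_simps)
    also have "\<dots> \<le> (3 * real (N div 2)) * real (card (rough_upto k x))"
      using N2 R s by (intro mult_mono) auto
    also have "\<dots> = 3 * real ((N div 2) * card (rough_upto k x))" by simp
    also have "\<dots> \<le> 3 * real (k * (t * (n * n)))"
      using few unfolding x_def N_def by (simp only: of_nat_le_iff mult_left_mono)
    also have "\<dots> = real N * (3 * (real k * real n))" by (simp add: N_def mult_ac)
    finally have le: "real N * (real N / (16 * real k * s)) \<le> real N * (3 * (real k * real n))" .
    have "real N > 0" using N k by linarith
    with le have "real N / (16 * real k * s) \<le> 3 * (real k * real n)"
      by (simp only: mult_le_cancel_left_pos)
    hence "real N \<le> 48 * (real k * real k * s) * real n"
      using s k by (simp add: field_simps)
    hence "real t * real n \<le> (48 * (real k * real k * s)) * real n" by (simp add: N_def)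
    hence "real t \<le> 48 * (real k * real k * s)" using n by (subst (asm) mult_le_cancel_right_pos) auto
    moreover have "real k * real k * s > 0" using k s by simp
    ultimately show False using t' by linarith
  qed
qed

lemma T_le_eventually:
  "\<forall>\<^sub>F k in sequentially. real (T k) \<le> 50 * real k powr (5 / 2)"
  using eventually_card_rough_ge eventually_ge_at_top[of 1]
proof eventually_elim
  case (elim k)
  define y where "y = (real k)\<^sup>2 * sqrt (real k)"
  have "y = real k powr 2 * real k powr (1 / 2)"
    using elim by (simp add: y_def powr_half_sqrt)
  hence y: "y = real k powr (5 / 2)" unfolding powr_add[symmetric] by simp
  have y1: "y \<ge> 1" unfolding y using elim by (intro ge_one_powr_ge_zero) auto
  \<comment> \<open>Rounding up adds less than 1, hence at most \<open>y\<close>, which turns 49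
    into 50.\<close>
  define t where "t = nat \<lceil>49 * y\<rceil>"
  have t: "real t \<ge> 49 * y" "real t \<le> 50 * y" using y1 unfolding t_def by linarith+
  have "forces_rainbow_AP k t"
    using elim t(1) by (intro forces_rainbow_AP_if_large) (auto simp: y_def)
  moreover have "t \<ge> 1" using t(1) y1 by linarith
  ultimately have "T k \<le> t" unfolding T_def by (intro Least_le) auto
  thus ?case using t(2) y by linarith
qed

theorem theorem4:
  fixes \<epsilon> :: real
  assumes "\<epsilon> > 0"
  shows "\<exists>C>0. \<forall>k\<ge>3. real (T k) \<le> C * real k powr (5 / 2 + \<epsilon>)"
proof -
  obtain K where K: "\<And>k. k \<ge> K \<Longrightarrow> real (T k) \<le> 50 * real k powr (5 / 2)"
    using T_le_eventually unfolding eventually_sequentially by blast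
  \<comment> \<open>The sum absorbs the finitely many \<open>k\<close> below the threshold
    \<open>K\<close>; for those with \<open>k >= 3\<close> the power of \<open>k\<close> is at least
    1.\<close>
  define C where "C = 50 + (\<Sum>k<K. real (T k))"
  have C: "C \<ge> 50" by (simp add: C_def sum_nonneg)
  have "real (T k) \<le> C * real k powr (5 / 2 + \<epsilon>)" if "k \<ge> 3" for k
  proof (cases "k \<ge> K")
    case True
    have "real (T k) \<le> 50 * real k powr (5 / 2)" by (rule K) (rule True)
    also have "\<dots> \<le> C * real k powr (5 / 2 + \<epsilon>)"
      using C assms that by (intro mult_mono powr_mono) auto
    finally show ?thesis .
  next
    case False
    hence "real (T k) \<le> (\<Sum>k<K. real (T k))" by (intro member_le_sum) auto
    also have "\<dots> \<le> C * 1" by (simp add: C_def)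
    also have "\<dots> \<le> C * real k powr (5 / 2 + \<epsilon>)"
      using C assms that by (intro mult_left_mono ge_one_powr_ge_zero) auto
    finally show ?thesis .
  qed
  with C show ?thesis by (intro exI[of _ C]) auto
qed

end
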